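(* Let $M=\mathbb R^n/\Gamma$ be a flat noncompact complete Riemannian manifold, where $\Gamma\subset E(n)$ is a discrete, fixed-point-free subgroup of the Euclidean group. Then there exist an integer $s$ with $1\le s\le n$ and a compact flat manifold $Z$ of dimension $n-s$ with the following property: for every sufficiently large $R>0$ there is an isometric embedding \[ Z\times B^s(R)\to\mathbb R^n/\Gamma, \] where $B^s(R)$ is a ball of radius $R$ in Euclidean $\mathbb R^s$ and $Z\times B^s(R)$ carries the product metric. (Here $Z$ is a point if $s=n$.)
   Context: $E(n)$ is the Euclidean group of isometries $x\mapsto gx+a$ of $\mathbb R^n$, with $g\in O(n)$ and $a\in\mathbb R^n$. *)

theory Defs
  imports "HOL-Analysis.Analysis"
begin

text \<open>Euclidean motions of a linear subspace V of the ambient Euclidean space 'a,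
  represented by their canonical extension to 'a that fixes the orthogonal
  complement of V pointwise: x |-> g x + a with g orthogonal, g V = V, a in V.
  For V = UNIV this is exactly the Euclidean group E(n), n = DIM('a).\<close>
definition motion_of :: "'a::euclidean_space set \<Rightarrow> ('a \<Rightarrow> 'a) \<Rightarrow> bool" where
  "motion_of V f \<longleftrightarrow> (\<exists>g a. orthogonal_transformation g \<and> g ` V \<subseteq> V
      \<and> (\<forall>w. (\<forall>v\<in>V. inner v w = 0) \<longrightarrow> g w = w) \<and> a \<in> V \<and> f = (\<lambda>x. g x + a))"

text \<open>Gamma is a discrete, fixed-point-free subgroup of E(V). Discreteness is with
  respect to the Lie group topology of E(V) (equivalently uniform convergence on
  the unit ball of V).\<close>
definition discrete_free_group :: "'a::euclidean_space set \<Rightarrow> ('a \<Rightarrow> 'a) set \<Rightarrow> bool" where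
  "discrete_free_group V G \<longleftrightarrow>
     G \<subseteq> {f. motion_of V f} \<and> id \<in> G
     \<and> (\<forall>f\<in>G. \<forall>h\<in>G. f \<circ> h \<in> G) \<and> (\<forall>f\<in>G. inv f \<in> G)
     \<and> (\<forall>f\<in>G. \<exists>e>0. \<forall>h\<in>G. (\<forall>x\<in>V. norm x \<le> 1 \<longrightarrow> dist (h x) (f x) < e) \<longrightarrow> h = f)
     \<and> (\<forall>f\<in>G. \<forall>x\<in>V. f x = x \<longrightarrow> f = id)"

definition orbit :: "('a \<Rightarrow> 'a) set \<Rightarrow> 'a \<Rightarrow> 'a set" where
  "orbit G x = (\<lambda>f. f x) ` G"

definition quot_points :: "'a set \<Rightarrow> ('a \<Rightarrow> 'a) set \<Rightarrow> 'a set set" where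
  "quot_points V G = orbit G ` V"

definition odist :: "'a::metric_space set \<Rightarrow> 'a set \<Rightarrow> real" where
  "odist A B = Inf {dist a b | a b. a \<in> A \<and> b \<in> B}"

text \<open>Compactness of V/G in the quotient topology: a set of orbits is open iff
  its union (the preimage under the projection) is open in V.\<close>
definition quot_compact :: "'a::euclidean_space set \<Rightarrow> ('a \<Rightarrow> 'a) set \<Rightarrow> bool" where
  "quot_compact V G \<longleftrightarrow>
     (\<forall>\<U>. (\<forall>U\<in>\<U>. U \<subseteq> quot_points V G \<and> openin (top_of_set V) (\<Union>U))
          \<and> quot_points V G \<subseteq> \<Union>\<U>
      \<longrightarrow> (\<exists>\<V>\<subseteq>\<U>. finite \<V> \<and> quot_points V G \<subseteq> \<Union>\<V>))"

definition prod_dist :: "'a::euclidean_space set \<times> 'a \<Rightarrow> 'a set \<times> 'a \<Rightarrow> real" where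
  "prod_dist p q = sqrt ((odist (fst p) (fst q))\<^sup>2 + (dist (snd p) (snd q))\<^sup>2)"

text \<open>Isometric embedding (in the Riemannian sense) of the open product
  Z x B^s(R) into R^n/Gamma: an injective map that is locally distance preserving
  (equal dimensions, so this is the same as a Riemannian isometric embedding).\<close>
definition isometric_embedding ::
  "('a::euclidean_space set \<times> 'a) set \<Rightarrow> 'a set set \<Rightarrow> ('a set \<times> 'a \<Rightarrow> 'a set) \<Rightarrow> bool" where
  "isometric_embedding D M f \<longleftrightarrow>
     f ` D \<subseteq> M \<and> inj_on f D
     \<and> (\<forall>p\<in>D. \<exists>e>0. \<forall>q\<in>D. \<forall>q'\<in>D. prod_dist p q < e \<and> prod_dist p q' < e
            \<longrightarrow> odist (f q) (f q') = prod_dist q q')"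

end

theory Submission
  imports Defs
begin

text \<open>If the orbit of the origin is not coarsely dense in \<open>V\<close>, then the linear functionals that are
  bounded on the orbit form a nonzero subspace \<open>L\<close> of \<open>V\<close>, invariant under all linear parts.
  Let \<open>V1\<close> be the orthogonal complement of \<open>L\<close> in \<open>V\<close> and \<open>\<Delta>\<close> the subgroup whose linear parts are
  trivial on the orthogonal complement of \<open>V1\<close>; it consists of motions of \<open>V1\<close>.  Far out in a
  direction orthogonal to \<open>V1\<close> that is moved by every linear part nontrivial there, all elements
  of the group outside \<open>\<Delta>\<close> have large displacement.  Iterating, one reaches a subgroup
  \<open>\<Delta>\<close> acting cocompactly on a subspace \<open>V\<close>, together with points that are moved at most a
  prescribed distance only by elements of \<open>\<Delta>\<close>.  Around such a point the quotient looks like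
  \<open>V/\<Delta>\<close> times a ball in the orthogonal complement of \<open>V\<close>.\<close>

section \<open>Linear parts of motions and fixed points of orthogonal groups\<close>

definition linear_part :: "('a::euclidean_space \<Rightarrow> 'a) \<Rightarrow> 'a \<Rightarrow> 'a" where
  "linear_part f x = f x - f 0"

text \<open>The rotation and the translation are determined by \<open>f\<close>, because a linear
  map sends 0 to 0. This removes the existential quantifiers of \<open>motion_of\<close>.\<close>

lemma motion_of_iff:
  "motion_of V f \<longleftrightarrow> orthogonal_transformation (linear_part f) \<and> linear_part f ` V \<subseteq> V
     \<and> (\<forall>w\<in>V\<^sup>\<bottom>. linear_part f w = w) \<and> f 0 \<in> V" (is "?L \<longleftrightarrow> ?R")
proof
  assume ?L
  then obtain g a where g: "orthogonal_transformation g" "g ` V \<subseteq> V"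
      "\<forall>w. (\<forall>v\<in>V. inner v w = 0) \<longrightarrow> g w = w" "a \<in> V" "f = (\<lambda>x. g x + a)"
    by (auto simp: motion_of_def)
  have "g 0 = 0" using g(1) by (simp add: orthogonal_transformation_linear linear_0)
  then have "linear_part f = g" "f 0 = a" using g(5) by (auto simp: linear_part_def)
  then show ?R using g by (auto simp: orthogonal_comp_def orthogonal_def)
next
  assume ?R
  then show ?L unfolding motion_of_def
    by (intro exI[of _ "linear_part f"] exI[of _ "f 0"])
       (auto simp: orthogonal_comp_def orthogonal_def linear_part_def)
qed

lemma orthogonal_decomp:
  fixes V :: "'a::euclidean_space set"
  assumes "subspace V"
  obtains y z where "y \<in> V" "z \<in> V\<^sup>\<bottom>" "x = y + z"
proof -
  have "x \<in> V + V\<^sup>\<bottom>" using subspace_sum_orthogonal_comp[OF assms] by simp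
  then show thesis using that by (elim set_plus_elim)
qed

text \<open>A point fixed by \<open>H\<close> is determined inside the closed convex hull of an orbit, because all
  points of the hull have the same inner product with it.  If it were missing from the hull
  itself, a separating functional would be nonnegative on the hull and, by compactness of the
  closure of the orbit, bounded below by a positive constant on the orbit of a suitable average.\<close>
lemma orthogonal_group_fixed_point_in_hull:
  fixes H :: "('a::euclidean_space \<Rightarrow> 'a) set" and v :: 'a
  assumes orth: "\<And>h. h \<in> H \<Longrightarrow> orthogonal_transformation h"
    and id: "id \<in> H"
    and comp: "\<And>h k. h \<in> H \<Longrightarrow> k \<in> H \<Longrightarrow> h \<circ> k \<in> H"
    and inv: "\<And>h. h \<in> H \<Longrightarrow> inv h \<in> H"
  obtains b where "b \<in> convex hull ((\<lambda>h. h v) ` H)" "\<And>h. h \<in> H \<Longrightarrow> h b = b"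
proof -
  define S where "S w = convex hull ((\<lambda>h. h w) ` H)" for w
  \<comment> \<open>The closest point of the closed hull to the origin is fixed: each
    \<open>h\<close> maps the closed hull into itself and preserves norms, and the closest point is
    unique.\<close>
  define q where "q w = closest_point (closure (S w)) 0" for w
  have lin: "linear h" if "h \<in> H" for h using orth[OF that] by (rule orthogonal_transformation_linear)
  have S_ne: "S w \<noteq> {}" for w using id by (auto simp: S_def)
  have q_in: "q w \<in> closure (S w)" for w
    unfolding q_def by (rule closest_point_in_set) (use S_ne in auto)
  have q_fixed: "h (q w) = q w" if h: "h \<in> H" for h w
  proof -
    have "h ` S w = convex hull (h ` (\<lambda>k. k w) ` H)"
      unfolding S_def by (simp add: convex_hull_linear_image lin[OF h])
    also have "\<dots> \<subseteq> S w"
      unfolding S_def by (rule hull_mono) (use comp[OF h] in \<open>force simp: o_def\<close>)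
    finally have "h ` closure (S w) \<subseteq> closure (S w)"
      by (meson closure_linear_image_subset closure_mono lin[OF h] order_trans)
    then have "h (q w) \<in> closure (S w)" using q_in by blast
    moreover have "\<forall>z\<in>closure (S w). dist 0 (h (q w)) \<le> dist 0 z"
      using closest_point_exists(2)[of "closure (S w)" 0] S_ne orthogonal_transformation_norm[OF orth[OF h]]
      by (simp add: q_def)
    ultimately show ?thesis
      unfolding q_def by (intro closest_point_unique) (auto simp: S_def convex_closure)
  qed
  have hull_inner: "y \<bullet> f = w \<bullet> f"
    if f: "\<And>h. h \<in> H \<Longrightarrow> h f = f" and y: "y \<in> closure (S w)" for y f w
  proof -
    have "h w \<in> {y. f \<bullet> y = f \<bullet> w}" if "h \<in> H" for h
      using orth[OF that] f[OF that] by (simp, metis orthogonal_transformation_def)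
    then have "S w \<subseteq> {y. f \<bullet> y = f \<bullet> w}"
      unfolding S_def by (intro hull_minimal) (auto simp: convex_hyperplane)
    then have "closure (S w) \<subseteq> {y. f \<bullet> y = f \<bullet> w}"
      by (rule closure_minimal) (simp add: closed_hyperplane)
    then show ?thesis using y by (auto simp: inner_commute)
  qed
  define b where "b = q v"
  have "b \<in> S v"
  proof (rule ccontr)
    assume b: "b \<notin> S v"
    define T where "T = (\<lambda>x. - b + x) ` S v"
    have "convex T" unfolding T_def S_def by (intro convex_translation) simp
    moreover have "T \<noteq> {}" "0 \<notin> T" using S_ne b by (auto simp: T_def)
    \<comment> \<open>Taking \<open>a\<close> in the span of \<open>T\<close> ensures that it is not
      orthogonal to all of \<open>T\<close>; otherwise it would be orthogonal to itself.\<close>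
    ultimately obtain a where a: "a \<in> span T" "a \<noteq> 0" "\<And>x. x \<in> T \<Longrightarrow> 0 \<le> a \<bullet> x"
      by (metis separating_hyperplane_set_0_inspan)
    have a_pos: "0 \<le> a \<bullet> (h v - b)" if "h \<in> H" for h
      using a(3)[of "- b + h v"] that hull_inc[of "h v" "(\<lambda>h. h v) ` H"] unfolding T_def S_def by auto
    have "\<exists>h\<in>H. 0 < a \<bullet> (h v - b)"
    proof (rule ccontr)
      assume "\<not> ?thesis"
      then have "a \<bullet> h v = a \<bullet> b" if "h \<in> H" for h
        using a_pos[OF that] that by (force simp: inner_diff_right)
      then have "S v \<subseteq> {y. a \<bullet> y = a \<bullet> b}"
        unfolding S_def by (intro hull_minimal) (auto simp: convex_hyperplane)
      then have "orthogonal a y" if "y \<in> T" for y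
        using that by (auto simp: T_def orthogonal_def inner_diff_right)
      then have "orthogonal a a" using a(1) orthogonal_to_span by blast
      then show False using a(2) by (simp add: orthogonal_def)
    qed
    then obtain h0 where h0: "h0 \<in> H" and c: "0 < a \<bullet> (h0 v - b)" by blast
    define c where "c = a \<bullet> (h0 v - b)"
    \<comment> \<open>A displacement of norm at most \<open>e\<close> changes the inner product with
      \<open>a\<close> by at most half of the gap \<open>c\<close>.\<close>
    define e where "e = c / (2 * norm a)"
    have e: "0 < e" "norm a * e = c / 2" using c a(2) by (auto simp: e_def c_def)
    let ?O = "(\<lambda>h. h v) ` H"
    have "bounded ?O" using orth
      by (auto simp: bounded_iff orthogonal_transformation_norm intro!: exI[of _ "norm v"])
    then have "compact (closure ?O)" by simp
    moreover have "closure ?O \<subseteq> (\<Union>h\<in>H. ball (h v) e)"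
      using e(1) by (auto simp: closure_approachable dist_commute)
    ultimately obtain F where F: "F \<subseteq> H" "finite F" "closure ?O \<subseteq> (\<Union>h\<in>F. ball (h v) e)"
      by (metis compactE_image open_ball)
    define m where "m = real (card F)"
    have "F \<noteq> {}" using F(3) id closure_subset[of ?O] by auto
    then have m: "0 < m" using F(2) by (simp add: m_def card_gt_0_iff)
    \<comment> \<open>\<open>x\<close> is the average of a finite \<open>e\<close>-net of the
      orbit.\<close>
    define x where "x = (\<Sum>h\<in>F. (1 / m) *\<^sub>R h v)"
    have xS: "x \<in> S v"
      unfolding x_def S_def
      by (rule convex_sum) (use F m in \<open>auto simp: m_def intro!: hull_inc\<close>)
    \<comment> \<open>Every \<open>k\<close> carries some net point to within \<open>e\<close> of
      \<open>h0 v\<close>. That point contributes at least \<open>c / 2\<close> to the sum and no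
      other contribution is negative, so the average exceeds the value at \<open>b\<close> by at
      least \<open>c / (2 * m)\<close>, uniformly in \<open>k\<close>.\<close>
    have key: "c / (2 * m) + a \<bullet> b \<le> a \<bullet> k x" if k: "k \<in> H" for k
    proof -
      have "bij k" using orth[OF k] by (rule orthogonal_transformation_bij)
      have "inv k (h0 v) \<in> ?O" using comp[OF inv[OF k] h0] by (auto intro!: image_eqI[of _ _ "inv k \<circ> h0"])
      then obtain h where h: "h \<in> F" "dist (h v) (inv k (h0 v)) < e"
        using F(3) closure_subset[of ?O] by force
      have "dist (k (h v)) (k (inv k (h0 v))) < e"
        using h(2) orth[OF k] by (simp add: orthogonal_transformation_isometry)
      then have "norm (h0 v - k (h v)) \<le> e"
        using \<open>bij k\<close> by (simp add: bij_is_surj surj_f_inv_f dist_norm norm_minus_commute)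
      then have "norm a * norm (h0 v - k (h v)) \<le> c / 2"
        unfolding e(2)[symmetric] by (intro mult_left_mono) auto
      then have "\<bar>a \<bullet> (h0 v - k (h v))\<bar> \<le> c / 2"
        using Cauchy_Schwarz_ineq2[of a "h0 v - k (h v)"] by linarith
      then have "c / 2 \<le> a \<bullet> (k (h v) - b)"
        using abs_le_D1 unfolding c_def inner_diff_right by fastforce
      also have "\<dots> \<le> (\<Sum>h\<in>F. a \<bullet> (k (h v) - b))"
        by (rule member_le_sum) (use h F a_pos[OF comp[OF k]] in \<open>auto simp: subset_iff\<close>)
      also have "\<dots> = m * (a \<bullet> k x) - m * (a \<bullet> b)"
        using m by (simp add: x_def linear_sum[OF lin[OF k]] linear_cmul[OF lin[OF k]] inner_diff_right
             sum_subtractf m_def inner_sum_right flip: sum_divide_distrib)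
      finally show ?thesis using m by (simp add: field_simps)
    qed
    have "S x \<subseteq> {y. c / (2 * m) + a \<bullet> b \<le> a \<bullet> y}"
      unfolding S_def by (intro hull_minimal) (auto simp: key convex_halfspace_ge)
    then have "closure (S x) \<subseteq> {y. c / (2 * m) + a \<bullet> b \<le> a \<bullet> y}"
      by (rule closure_minimal) (simp add: closed_halfspace_ge)
    then have "c / (2 * m) + a \<bullet> b \<le> a \<bullet> q x" using q_in by blast
    \<comment> \<open>The difference \<open>q x - b\<close> is fixed, so \<open>q x\<close>,
      \<open>x\<close>, \<open>v\<close> and \<open>b\<close> all have the same inner product with
      it; hence it is orthogonal to itself.\<close>
    moreover have "q x = b"
    proof -
      have fixed: "h (q x - b) = q x - b" if "h \<in> H" for h
        using q_fixed[OF that] by (simp add: b_def linear_diff[OF lin[OF that]])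
      have "q x \<bullet> (q x - b) = x \<bullet> (q x - b)" by (rule hull_inner) (use fixed q_in in auto)
      also have "\<dots> = v \<bullet> (q x - b)"
        by (rule hull_inner) (use fixed xS closure_subset in auto)
      also have "\<dots> = b \<bullet> (q x - b)"
        by (rule hull_inner[symmetric]) (use fixed q_in in \<open>auto simp: b_def\<close>)
      finally have "(q x - b) \<bullet> (q x - b) = 0" by (simp add: inner_diff_left)
      then show ?thesis by simp
    qed
    ultimately show False using c m by (simp add: c_def field_simps)
  qed
  then show thesis using that q_fixed unfolding S_def b_def by blast
qed

section \<open>Discrete groups of motions of the whole space\<close>

text \<open>A metric form of cocompactness, which is easier to negate and to iterate than
  \<open>quot_compact\<close>.\<close>

definition coarsely_dense :: "'a::euclidean_space set \<Rightarrow> ('a \<Rightarrow> 'a) set \<Rightarrow> bool" where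
  "coarsely_dense V G \<longleftrightarrow> (\<exists>R. \<forall>x\<in>V. \<exists>f\<in>G. dist x (f 0) \<le> R)"

locale discrete_motion_group =
  fixes G :: "('a::euclidean_space \<Rightarrow> 'a) set"
  assumes dfg: "discrete_free_group UNIV G"
begin

lemma id_in: "id \<in> G"
  and comp_in: "f \<in> G \<Longrightarrow> h \<in> G \<Longrightarrow> f \<circ> h \<in> G"
  and inv_in: "f \<in> G \<Longrightarrow> inv f \<in> G"
  and free: "f \<in> G \<Longrightarrow> f x = x \<Longrightarrow> f = id"
  using dfg by (auto simp: discrete_free_group_def)

lemma orthogonal_linear_part: "f \<in> G \<Longrightarrow> orthogonal_transformation (linear_part f)"
  using dfg by (auto simp: discrete_free_group_def motion_of_iff)

lemma linear_linear_part: "f \<in> G \<Longrightarrow> linear (linear_part f)"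
  by (simp add: orthogonal_linear_part orthogonal_transformation_linear)

lemma norm_linear_part: "f \<in> G \<Longrightarrow> norm (linear_part f x) = norm x"
  by (simp add: orthogonal_linear_part orthogonal_transformation_norm)

lemma inner_linear_part: "f \<in> G \<Longrightarrow> linear_part f x \<bullet> linear_part f y = x \<bullet> y"
  using orthogonal_linear_part by (auto simp: orthogonal_transformation_def)

lemma dist_apply: "f \<in> G \<Longrightarrow> dist (f x) (f y) = dist x y"
  using norm_linear_part[of f "x - y"] linear_linear_part[of f]
  by (simp add: dist_norm linear_diff) (simp add: linear_part_def)

lemma bij: "f \<in> G \<Longrightarrow> bij f"
proof -
  assume "f \<in> G"
  then have "bij (\<lambda>x. linear_part f x + f 0)"
    using bij_comp[OF orthogonal_transformation_bij[OF orthogonal_linear_part] bij_plus_right, of f "f 0"]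
    by (simp add: o_def)
  then show "bij f" by (simp add: linear_part_def)
qed

lemma inv_apply: "f \<in> G \<Longrightarrow> inv f (f x) = x" "f \<in> G \<Longrightarrow> f (inv f x) = x"
  using bij by (auto simp: bij_is_inj bij_is_surj surj_f_inv_f)

lemma linear_part_comp: "f \<in> G \<Longrightarrow> linear_part (f \<circ> h) = linear_part f \<circ> linear_part h"
  using linear_diff[OF linear_linear_part, of f] by (auto simp: linear_part_def fun_eq_iff)

lemma linear_part_inv: "f \<in> G \<Longrightarrow> linear_part (inv f) = inv (linear_part f)"
proof -
  assume f: "f \<in> G"
  have "linear_part (inv f) \<circ> linear_part f = id" "linear_part f \<circ> linear_part (inv f) = id"
    using linear_part_comp[OF inv_in[OF f], of f] linear_part_comp[OF f, of "inv f"] inv_apply[OF f]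
    by (auto simp: linear_part_def fun_eq_iff)
  then show ?thesis by (metis inv_unique_comp)
qed

text \<open>Translation and linear part embed the group in a finite-dimensional normed space. The
  image is bounded because orthogonal maps have operator norm at most 1. It is uniformly discrete
  because composing with \<open>inv h\<close> preserves distances, so discreteness at
  \<open>id\<close> separates all pairs by the same amount.\<close>

lemma finite_bounded: "finite {f \<in> G. norm (f 0) \<le> R}"
proof -
  define A where "A = {f \<in> G. norm (f 0) \<le> R}"
  define \<Phi> where "\<Phi> f = (f 0, Blinfun (linear_part f))" for f :: "'a \<Rightarrow> 'a"
  have app: "blinfun_apply (snd (\<Phi> f)) x = linear_part f x" if "f \<in> G" for f x
    using linear_linear_part[OF that]
    by (simp add: \<Phi>_def bounded_linear_Blinfun_apply linear_conv_bounded_linear)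
  have "\<exists>e>0. \<forall>h\<in>G. (\<forall>x\<in>UNIV. norm x \<le> 1 \<longrightarrow> dist (h x) (id x) < e) \<longrightarrow> h = id"
    using dfg id_in unfolding discrete_free_group_def by blast
  then obtain e where e: "e > 0" "\<And>h. h \<in> G \<Longrightarrow> \<forall>x. norm x \<le> 1 \<longrightarrow> dist (h x) x < e \<Longrightarrow> h = id"
    by auto
  have sep: "f = h" if f: "f \<in> G" and h: "h \<in> G" and d: "dist (\<Phi> f) (\<Phi> h) < e / 2" for f h
  proof -
    have "dist (f x) (h x) < e" if "norm x \<le> 1" for x
    proof -
      have "norm (linear_part f x - linear_part h x) = norm (blinfun_apply (snd (\<Phi> f) - snd (\<Phi> h)) x)"
        using f h by (simp add: blinfun.diff_left app)
      also have "\<dots> \<le> norm (snd (\<Phi> f) - snd (\<Phi> h)) * norm x" by (rule norm_blinfun)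
      also have "\<dots> \<le> dist (\<Phi> f) (\<Phi> h) * 1"
        by (rule mult_mono) (use that dist_snd_le[of "\<Phi> f" "\<Phi> h"] in \<open>auto simp: dist_norm\<close>)
      finally have "norm (linear_part f x - linear_part h x) < e / 2" using d by simp
      moreover have "norm (f 0 - h 0) < e / 2"
        using dist_fst_le[of "\<Phi> f" "\<Phi> h"] d by (simp add: \<Phi>_def dist_norm)
      ultimately have "norm ((linear_part f x - linear_part h x) + (f 0 - h 0)) < e"
        using norm_triangle_ineq[of "linear_part f x - linear_part h x" "f 0 - h 0"] by simp
      then show ?thesis by (simp add: linear_part_def dist_norm)
    qed
    then have "dist ((inv h \<circ> f) x) x < e" if "norm x \<le> 1" for x
      using dist_apply[OF inv_in[OF h], of "f x" "h x"] inv_apply[OF h] that by simp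
    then have "inv h \<circ> f = id" using e(2) comp_in inv_in f h by blast
    then show "f = h" using inv_apply(2)[OF h] by (metis comp_apply ext id_apply)
  qed
  have "uniform_discrete (\<Phi> ` A)"
    unfolding uniform_discrete_def
  proof (intro exI[of _ "e / 2"] conjI ballI impI)
    show "p = q" if "p \<in> \<Phi> ` A" "q \<in> \<Phi> ` A" "dist p q < e / 2" for p q
      using that sep unfolding A_def by blast
  qed (use e(1) in simp)
  moreover have "norm (\<Phi> f) \<le> R + 1" if "f \<in> A" for f
  proof -
    have "norm (snd (\<Phi> f)) \<le> 1"
      by (rule norm_blinfun_bound) (use that in \<open>auto simp: app A_def norm_linear_part\<close>)
    then show ?thesis using that norm_Pair_le[of "f 0" "Blinfun (linear_part f)"]
      by (simp add: \<Phi>_def A_def)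
  qed
  then have "bounded (\<Phi> ` A)" by (auto simp: bounded_iff)
  ultimately have "finite (\<Phi> ` A)" using uniform_discrete_finite_iff by blast
  moreover have "inj_on \<Phi> A"
    by (rule inj_onI) (rule sep, use e(1) in \<open>auto simp: A_def\<close>)
  ultimately show ?thesis using finite_imageD unfolding A_def by blast
qed

lemma countable: "countable G"
proof -
  have "G \<subseteq> (\<Union>n. {f \<in> G. norm (f 0) \<le> real n})" using real_arch_simple by auto
  then show ?thesis
    by (rule countable_subset) (simp add: countable_finite finite_bounded)
qed

end

section \<open>Groups acting on a subspace\<close>

text \<open>The elements stay motions of the whole space, so that one group can be compared with its
  subgroups acting on smaller subspaces.\<close>

locale discrete_motion_group_on = discrete_motion_group G
  for G :: "('a::euclidean_space \<Rightarrow> 'a) set" +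
  fixes V :: "'a set"
  assumes subspace: "subspace V"
    and motion: "f \<in> G \<Longrightarrow> motion_of V f"
begin

lemma linear_part_in: "f \<in> G \<Longrightarrow> x \<in> V \<Longrightarrow> linear_part f x \<in> V"
  and linear_part_orthogonal: "f \<in> G \<Longrightarrow> w \<in> V\<^sup>\<bottom> \<Longrightarrow> linear_part f w = w"
  and translation_in: "f \<in> G \<Longrightarrow> f 0 \<in> V"
  using motion by (auto simp: motion_of_iff)

lemma apply_in: "f \<in> G \<Longrightarrow> x \<in> V \<Longrightarrow> f x \<in> V"
  using subspace_add[OF subspace linear_part_in[of f x] translation_in[of f]]
  by (simp add: linear_part_def)

lemma apply_add_orthogonal: "f \<in> G \<Longrightarrow> w \<in> V\<^sup>\<bottom> \<Longrightarrow> f (x + w) = f x + w"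
  using linear_add[OF linear_linear_part, of f x w] linear_part_orthogonal[of f w]
  by (simp add: linear_part_def algebra_simps)

text \<open>Two elements differ at \<open>x\<close> exactly as they differ at the component of
  \<open>x\<close> in \<open>V\<close>, whose norm is at most that of \<open>x\<close>. Closeness on
  the unit ball of \<open>V\<close> is therefore closeness on the full unit ball.\<close>

lemma discrete_free_group: "discrete_free_group V G"
proof -
  have decomp: "\<exists>y\<in>V. norm y \<le> norm x \<and> (\<forall>f\<in>G. f x = f y + (x - y))" for x
  proof -
    obtain y w where yw: "y \<in> V" "w \<in> V\<^sup>\<bottom>" "x = y + w"
      using orthogonal_decomp[OF subspace] .
    then have "orthogonal y w" by (simp add: orthogonal_comp_def)
    then have "(norm x)\<^sup>2 = (norm y)\<^sup>2 + (norm w)\<^sup>2" using yw by (simp add: norm_add_Pythagorean)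
    then have "norm y \<le> norm x" by (simp add: power2_le_imp_le)
    then show ?thesis using yw apply_add_orthogonal by auto
  qed
  have "\<exists>e>0. \<forall>h\<in>G. (\<forall>x\<in>V. norm x \<le> 1 \<longrightarrow> dist (h x) (f x) < e) \<longrightarrow> h = f" if f: "f \<in> G" for f
  proof -
    obtain e where e: "e > 0" "\<forall>h\<in>G. (\<forall>x. norm x \<le> 1 \<longrightarrow> dist (h x) (f x) < e) \<longrightarrow> h = f"
      using dfg f by (auto simp: discrete_free_group_def)
    have "dist (h x) (f x) < e"
      if h: "h \<in> G" and *: "\<forall>x\<in>V. norm x \<le> 1 \<longrightarrow> dist (h x) (f x) < e" and x: "norm x \<le> 1" for h x
    proof -
      obtain y where y: "y \<in> V" "norm y \<le> norm x" "\<forall>f\<in>G. f x = f y + (x - y)" using decomp by blast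
      have "dist (h x) (f x) = dist (h y + (x - y)) (f y + (x - y))"
        using bspec[OF y(3) f] bspec[OF y(3) h] by simp
      then have "dist (h x) (f x) = dist (h y) (f y)" by (simp only: dist_add_cancel2)
      then show ?thesis using * x y by simp
    qed
    then show ?thesis using e by blast
  qed
  then show ?thesis
    using motion id_in comp_in inv_in free by (auto simp: discrete_free_group_def)
qed

text \<open>The direction is a limit of directions of points \<open>y\<close> going to infinity that are, up to an
  error of \<open>1\<close>, at least as close to the origin as to any other point of its orbit.\<close>
lemma escaping_direction:
  assumes "\<not> coarsely_dense V G"
  obtains u where "u \<in> V" "norm u = 1" "\<And>f. f \<in> G \<Longrightarrow> f 0 \<bullet> u \<le> 1"
proof -
  have "\<exists>y\<in>V. norm y > real (Suc n) \<and> (\<forall>f\<in>G. norm y \<le> dist y (f 0) + 1)" for n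
  proof -
    obtain x where x: "x \<in> V" "\<And>f. f \<in> G \<Longrightarrow> dist x (f 0) > real (Suc n)"
      using assms unfolding coarsely_dense_def by (meson not_le)
    define D where "D = (INF f\<in>G. dist x (f 0))"
    have bdd: "bdd_below ((\<lambda>f. dist x (f 0)) ` G)" by (auto intro!: bdd_belowI[of _ 0])
    have "D < D + 1" by simp
    \<comment> \<open>The infimum \<open>D\<close> is approached to within 1 at \<open>f 0\<close>;
      applying \<open>inv f\<close> moves this almost nearest orbit point to the origin.\<close>
    then obtain f where f: "f \<in> G" "dist x (f 0) < D + 1"
      using id_in cINF_less_iff[OF _ bdd] unfolding D_def by (metis empty_iff)
    define y where "y = inv f x"
    have y: "norm y = dist x (f 0)"
      using dist_apply[OF f(1), of y 0] inv_apply[OF f(1)] by (simp add: y_def)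
    have "norm y \<le> dist y (h 0) + 1" if h: "h \<in> G" for h
    proof -
      have "D \<le> dist x ((f \<circ> h) 0)"
        unfolding D_def by (rule cINF_lower[OF bdd comp_in[OF f(1) h]])
      also have "\<dots> = dist y (h 0)"
        using dist_apply[OF f(1), of y "h 0"] inv_apply[OF f(1)] by (simp add: y_def)
      finally show ?thesis using f(2) y by simp
    qed
    then show ?thesis using x y f apply_in[OF inv_in[OF f(1)]] y_def by metis
  qed
  then obtain y where y: "\<And>n. y n \<in> V" "\<And>n. norm (y n) > real (Suc n)"
      "\<And>n f. f \<in> G \<Longrightarrow> norm (y n) \<le> dist (y n) (f 0) + 1"
    by metis
  define u where "u n = y n /\<^sub>R norm (y n)" for n
  have ypos: "norm (y n) > 0" for n using y(2)[of n] by linarith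
  have "compact (sphere 0 1 \<inter> V)" by (simp add: closed_subspace compact_Int_closed subspace)
  moreover have "\<forall>n. u n \<in> sphere 0 1 \<inter> V"
    using y(1) ypos subspace by (auto simp: u_def subspace_scale)
  ultimately obtain l r where l: "l \<in> sphere 0 1 \<inter> V" "strict_mono r" "(u \<circ> r) \<longlonglongrightarrow> l"
    by (meson compact_imp_seq_compact seq_compactE)
  have "f 0 \<bullet> l \<le> 1" if f: "f \<in> G" for f
  proof -
    \<comment> \<open>Squaring the almost-nearest inequality and dividing by the norm of
      \<open>y n\<close> leaves the constant 1, which comes from the slack 1, and a term that
      vanishes in the limit.\<close>
    have bound: "f 0 \<bullet> u n \<le> 1 + (norm (f 0))\<^sup>2 * inverse (real (Suc n))" for n
    proof -
      have "(norm (y n) - 1)\<^sup>2 \<le> (dist (y n) (f 0))\<^sup>2"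
        by (rule power_mono) (use y(2)[of n] y(3)[OF f, of n] in auto)
      also have "\<dots> = (norm (y n))\<^sup>2 - 2 * (f 0 \<bullet> y n) + (norm (f 0))\<^sup>2"
        by (simp add: dist_norm power2_norm_eq_inner inner_diff_left inner_diff_right inner_commute)
      finally have "2 * (f 0 \<bullet> y n) \<le> 2 * norm (y n) + (norm (f 0))\<^sup>2"
        by (simp add: power2_diff)
      then have "f 0 \<bullet> y n \<le> norm (y n) + (norm (f 0))\<^sup>2"
        using zero_le_power2[of "norm (f 0)"] by linarith
      then have "f 0 \<bullet> u n \<le> 1 + (norm (f 0))\<^sup>2 * inverse (norm (y n))"
        using ypos[of n] by (simp add: u_def field_simps)
      also have "\<dots> \<le> 1 + (norm (f 0))\<^sup>2 * inverse (real (Suc n))"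
        by (intro add_left_mono mult_left_mono le_imp_inverse_le) (use y(2)[of n] in auto)
      finally show ?thesis .
    qed
    have "(\<lambda>n. f 0 \<bullet> (u \<circ> r) n) \<longlonglongrightarrow> f 0 \<bullet> l" by (intro tendsto_intros l(3))
    moreover have "(\<lambda>n. 1 + (norm (f 0))\<^sup>2 * inverse (real (Suc (r n)))) \<longlonglongrightarrow> 1 + (norm (f 0))\<^sup>2 * 0"
      by (intro tendsto_intros LIMSEQ_subseq_LIMSEQ[OF LIMSEQ_inverse_real_of_nat l(2), unfolded o_def])
    ultimately show ?thesis using LIMSEQ_le bound by fastforce
  qed
  then show thesis using that l(1) by auto
qed

end

section \<open>Subgroups, fixed vectors and invariant complements\<close>

lemma (in discrete_motion_group) subgroup:
  assumes "H \<subseteq> G" "id \<in> H" "\<And>f h. f \<in> H \<Longrightarrow> h \<in> H \<Longrightarrow> f \<circ> h \<in> H" "\<And>f. f \<in> H \<Longrightarrow> inv f \<in> H"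
  shows "discrete_motion_group H"
proof
  show "discrete_free_group UNIV H"
    unfolding discrete_free_group_def
  proof (intro conjI)
    show "\<forall>f\<in>H. \<exists>e>0. \<forall>h\<in>H. (\<forall>x\<in>UNIV. norm x \<le> 1 \<longrightarrow> dist (h x) (f x) < e) \<longrightarrow> h = f"
    proof
      fix f assume "f \<in> H"
      then have "\<exists>e>0. \<forall>h\<in>G. (\<forall>x\<in>UNIV. norm x \<le> 1 \<longrightarrow> dist (h x) (f x) < e) \<longrightarrow> h = f"
        using dfg assms(1) unfolding discrete_free_group_def by blast
      then show "\<exists>e>0. \<forall>h\<in>H. (\<forall>x\<in>UNIV. norm x \<le> 1 \<longrightarrow> dist (h x) (f x) < e) \<longrightarrow> h = f"
        using assms(1) by blast
    qed
    have "G \<subseteq> {f. motion_of UNIV f}" using dfg by (simp add: discrete_free_group_def)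
    then show "H \<subseteq> {f. motion_of UNIV f}" using assms(1) by (rule subset_trans[rotated])
    show "\<forall>f\<in>H. \<forall>x\<in>UNIV. f x = x \<longrightarrow> f = id" using free assms(1) by blast
  qed (use assms in auto)
qed

text \<open>When every linear part fixes \<open>b\<close>, the map taking \<open>f\<close> to
  \<open>f 0 \<bullet> b\<close> is a homomorphism into the additive reals. A homomorphism bounded
  above has no positive value, and applying this to inverses excludes negative ones.\<close>

lemma (in discrete_motion_group) translation_orthogonal_fixed:
  assumes fixed: "\<And>f. f \<in> G \<Longrightarrow> linear_part f b = b"
    and bound: "\<And>f. f \<in> G \<Longrightarrow> f 0 \<bullet> b \<le> B" and f: "f \<in> G"
  shows "f 0 \<bullet> b = 0"
proof -
  have add: "(f \<circ> h) 0 \<bullet> b = f 0 \<bullet> b + h 0 \<bullet> b" if "f \<in> G" for f h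
    using inner_linear_part[OF that, of "h 0" b] fixed[OF that]
    by (simp add: linear_part_def inner_diff_left)
  have le: "f 0 \<bullet> b \<le> 0" if f: "f \<in> G" for f
  proof -
    define s where "s = (SUP h\<in>G. h 0 \<bullet> b)"
    have "bdd_above ((\<lambda>h. h 0 \<bullet> b) ` G)" using bound by (auto simp: bdd_above_def)
    then have "f 0 \<bullet> b + h 0 \<bullet> b \<le> s" if "h \<in> G" for h
      using cSUP_upper[of "f \<circ> h" G "\<lambda>h. h 0 \<bullet> b"] comp_in[OF f that] add[OF f, of h]
      by (simp add: s_def)
    then have "s \<le> s - f 0 \<bullet> b"
      unfolding s_def using id_in by (intro cSUP_least) (auto simp: algebra_simps)
    then show ?thesis by simp
  qed
  have "(inv f \<circ> f) 0 = 0" using inv_apply(1)[OF f] by simp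
  then have "inv f 0 \<bullet> b + f 0 \<bullet> b = 0" using add[OF inv_in[OF f], of f] by simp
  then show ?thesis using le[OF f] le[OF inv_in[OF f]] by linarith
qed

text \<open>Inverses also preserve \<open>S\<close>, so each point of \<open>S\<close> is the image
  of a point of \<open>S\<close>, and linear parts preserve inner products.\<close>

lemma (in discrete_motion_group) linear_part_orthogonal_comp:
  assumes "\<And>f x. f \<in> G \<Longrightarrow> x \<in> S \<Longrightarrow> linear_part f x \<in> S" and f: "f \<in> G" and w: "w \<in> S\<^sup>\<bottom>"
  shows "linear_part f w \<in> S\<^sup>\<bottom>"
proof -
  have "x \<bullet> linear_part f w = 0" if x: "x \<in> S" for x
  proof -
    have "x = linear_part f (linear_part (inv f) x)"
      using linear_part_inv[OF f] orthogonal_transformation_bij[OF orthogonal_linear_part[OF f]]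
      by (simp add: bij_is_surj surj_f_inv_f)
    then have "x \<bullet> linear_part f w = linear_part (inv f) x \<bullet> w"
      using inner_linear_part[OF f] by metis
    then show ?thesis
      using assms(1)[OF inv_in[OF f] x] w by (auto simp: orthogonal_comp_def orthogonal_def)
  qed
  then show ?thesis by (auto simp: orthogonal_comp_def orthogonal_def)
qed

section \<open>Bounded functionals and passage to a smaller subspace\<close>

context discrete_motion_group_on
begin

text \<open>\<open>K\<close> is the barrier cone of the orbit of the origin.  If it contained no line, \<open>K - {0}\<close>
  would be convex, so it would contain a vector fixed by all linear parts; but a fixed vector
  in \<open>K\<close> is orthogonal to the whole orbit, hence spans a line in \<open>K\<close>.\<close>
lemma bounded_subspace:
  assumes "\<not> coarsely_dense V G"
  obtains L B where "subspace L" "L \<subseteq> V" "L \<noteq> {0}"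
    "\<And>f v. f \<in> G \<Longrightarrow> v \<in> L \<Longrightarrow> linear_part f v \<in> L"
    "0 \<le> B" "\<And>f v. f \<in> G \<Longrightarrow> v \<in> L \<Longrightarrow> \<bar>f 0 \<bullet> v\<bar> \<le> B * norm v"
proof -
  define K where "K = {v \<in> V. \<exists>B. \<forall>f\<in>G. f 0 \<bullet> v \<le> B}"
  \<comment> \<open>The lineality space of \<open>K\<close>: the functionals bounded on the orbit
    from both sides.\<close>
  define L where "L = {v. v \<in> K \<and> - v \<in> K}"
  have K_add: "x + y \<in> K" if "x \<in> K" "y \<in> K" for x y
  proof -
    from that obtain B C where "\<forall>f\<in>G. f 0 \<bullet> x \<le> B" "\<forall>f\<in>G. f 0 \<bullet> y \<le> C" by (auto simp: K_def)
    then have "\<forall>f\<in>G. f 0 \<bullet> (x + y) \<le> B + C" by (auto simp: inner_add_right intro: add_mono)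
    then show ?thesis using that subspace by (auto simp: K_def subspace_add)
  qed
  have K_scale: "c *\<^sub>R x \<in> K" if "x \<in> K" "0 \<le> c" for x c
  proof -
    from that obtain B where "\<forall>f\<in>G. f 0 \<bullet> x \<le> B" by (auto simp: K_def)
    then have "\<forall>f\<in>G. f 0 \<bullet> (c *\<^sub>R x) \<le> c * B" using that(2) by (auto intro: mult_left_mono)
    then show ?thesis using that subspace by (auto simp: K_def subspace_scale)
  qed
  have K_linear_part: "linear_part h v \<in> K" if h: "h \<in> G" and v: "v \<in> K" for h v
  proof -
    from v obtain B where B: "\<forall>f\<in>G. f 0 \<bullet> v \<le> B" by (auto simp: K_def)
    have "f 0 \<bullet> linear_part h v \<le> B + h 0 \<bullet> linear_part h v" if f: "f \<in> G" for f
    proof -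
      \<comment> \<open>Writing \<open>f\<close> as \<open>h\<close> after
        \<open>inv h \<circ> f\<close> moves the linear part off \<open>v\<close>, at the cost of a
        term independent of \<open>f\<close>.\<close>
      have "f 0 = linear_part h ((inv h \<circ> f) 0) + h 0"
        using inv_apply(2)[OF h] by (simp add: linear_part_def)
      then have "f 0 \<bullet> linear_part h v = (inv h \<circ> f) 0 \<bullet> v + h 0 \<bullet> linear_part h v"
        using inner_linear_part[OF h] by (metis inner_add_left)
      then show ?thesis using bspec[OF B comp_in[OF inv_in[OF h] f]] by simp
    qed
    then show ?thesis using linear_part_in[OF h] v by (auto simp: K_def)
  qed
  have "0 \<in> K" using subspace by (auto simp: K_def subspace_0)
  have L: "subspace L"
  proof (rule subspaceI)
    show "c *\<^sub>R x \<in> L" if "x \<in> L" for c x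
      using that K_scale[of x c] K_scale[of "-x" c] K_scale[of x "-c"] K_scale[of "-x" "-c"]
      by (cases "0 \<le> c") (auto simp: L_def)
    show "x + y \<in> L" if "x \<in> L" "y \<in> L" for x y
      using that K_add[of x y] K_add[of "-x" "-y"] by (auto simp: L_def)
  qed (use \<open>0 \<in> K\<close> in \<open>auto simp: L_def\<close>)
  have L_V: "L \<subseteq> V" by (auto simp: L_def K_def)
  have L_ne: "L \<noteq> {0}"
  proof
    assume L0: "L = {0}"
    obtain u where u: "u \<in> V" "norm u = 1" "\<And>f. f \<in> G \<Longrightarrow> f 0 \<bullet> u \<le> 1"
      using escaping_direction[OF assms] by blast
    have "u \<in> K" using u by (auto simp: K_def)
    obtain b where b: "b \<in> convex hull ((\<lambda>h. h u) ` linear_part ` G)"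
        "\<And>h. h \<in> linear_part ` G \<Longrightarrow> h b = b"
    proof (rule orthogonal_group_fixed_point_in_hull[of "linear_part ` G" u])
      have "linear_part id = id" by (auto simp: linear_part_def)
      then show "id \<in> linear_part ` G" using id_in by (metis image_eqI)
      show "h \<circ> k \<in> linear_part ` G" if "h \<in> linear_part ` G" "k \<in> linear_part ` G" for h k
        using that comp_in linear_part_comp by (auto simp flip: linear_part_comp)
      show "inv h \<in> linear_part ` G" if "h \<in> linear_part ` G" for h
        using that inv_in by (auto simp flip: linear_part_inv)
    qed (use orthogonal_linear_part in auto)
    have "convex (K - {0})"
    proof (rule convexI)
      fix x y s t assume xy: "x \<in> K - {0}" "y \<in> K - {0}" and st: "0 \<le> s" "0 \<le> t" "s + t = (1::real)"
      have "s *\<^sub>R x + t *\<^sub>R y \<noteq> 0"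
      proof
        assume "s *\<^sub>R x + t *\<^sub>R y = 0"
        then have "s *\<^sub>R x = - (t *\<^sub>R y)" by (simp add: eq_neg_iff_add_eq_0)
        then have "s *\<^sub>R x \<in> L" "t *\<^sub>R y \<in> L"
          using K_scale[of x s] K_scale[of y t] xy st by (auto simp: L_def)
        then have "s *\<^sub>R x = 0" "t *\<^sub>R y = 0" using L0 by auto
        then show False using xy st by auto
      qed
      then show "s *\<^sub>R x + t *\<^sub>R y \<in> K - {0}" using K_add K_scale xy st by auto
    qed
    moreover have "(\<lambda>h. h u) ` linear_part ` G \<subseteq> K - {0}"
      using K_linear_part[OF _ \<open>u \<in> K\<close>] norm_linear_part[of _ u] u(2) by force
    ultimately have "b \<in> K - {0}" using b(1) hull_minimal by blast
    then obtain B where "\<And>f. f \<in> G \<Longrightarrow> f 0 \<bullet> b \<le> B" by (auto simp: K_def)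
    then have "f 0 \<bullet> b = 0" if "f \<in> G" for f
      using translation_orthogonal_fixed b(2) that by blast
    then have "- b \<in> K" using \<open>b \<in> K - {0}\<close> subspace by (auto simp: K_def subspace_neg)
    then show False using \<open>b \<in> K - {0}\<close> L0 by (auto simp: L_def)
  qed
  have L_linear_part: "linear_part f v \<in> L" if "f \<in> G" "v \<in> L" for f v
    using that K_linear_part[of f v] K_linear_part[of f "- v"] linear_neg[OF linear_linear_part, of f v]
    by (auto simp: L_def)
  \<comment> \<open>A finite orthonormal basis turns the separate bounds for its vectors into one
    bound proportional to the norm.\<close>
  obtain E where E: "E \<subseteq> L" "pairwise orthogonal E" "\<And>x. x \<in> E \<Longrightarrow> norm x = 1" "independent E" "span E = L"
    by (metis orthonormal_basis_subspace[OF L])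
  have "finite E" using E(4) by (rule independent_imp_finite)
  have "\<exists>C. \<forall>f\<in>G. \<bar>f 0 \<bullet> e\<bar> \<le> C" if "e \<in> L" for e
  proof -
    from that obtain B1 B2 where "\<forall>f\<in>G. f 0 \<bullet> e \<le> B1" "\<forall>f\<in>G. f 0 \<bullet> - e \<le> B2"
      by (auto simp: L_def K_def)
    then show ?thesis by (intro exI[of _ "max B1 B2"]) (force simp: abs_le_iff)
  qed
  then obtain C where C: "\<And>e f. e \<in> L \<Longrightarrow> f \<in> G \<Longrightarrow> \<bar>f 0 \<bullet> e\<bar> \<le> C e" by metis
  have C_pos: "0 \<le> C e" if "e \<in> L" for e using C[OF that id_in] by simp
  have "\<bar>f 0 \<bullet> v\<bar> \<le> sum C E * norm v" if f: "f \<in> G" and v: "v \<in> L" for f v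
  proof -
    have "v = (\<Sum>e\<in>E. (v \<bullet> e) *\<^sub>R e)"
      using orthonormal_basis_expand[OF E(2,3) _ \<open>finite E\<close>, of v] E(5) v by simp
    then have "f 0 \<bullet> v = (\<Sum>e\<in>E. (v \<bullet> e) * (f 0 \<bullet> e))"
      by (metis (no_types, lifting) inner_scaleR_right inner_sum_right sum.cong)
    also have "\<bar>\<dots>\<bar> \<le> (\<Sum>e\<in>E. norm v * C e)"
    proof (rule sum_norm_le[where 'a=real, unfolded real_norm_def])
      fix e assume e: "e \<in> E"
      then have "\<bar>v \<bullet> e\<bar> \<le> norm v" using Cauchy_Schwarz_ineq2[of v e] E(3)[OF e] by simp
      moreover have "\<bar>f 0 \<bullet> e\<bar> \<le> C e" using C f e E(1) by blast
      ultimately show "\<bar>(v \<bullet> e) * (f 0 \<bullet> e)\<bar> \<le> norm v * C e"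
        unfolding abs_mult by (intro mult_mono) auto
    qed
    finally show ?thesis by (simp add: sum_distrib_left mult.commute)
  qed
  moreover have "0 \<le> sum C E" using C_pos E(1) by (auto intro: sum_nonneg)
  ultimately show thesis using that[OF L L_V L_ne] L_linear_part by blast
qed

text \<open>The arbitrary point \<open>x1\<close> makes the result iterable: an element with small
  displacement at \<open>x\<close> has equally small displacement at \<open>x1\<close>, so a point
  already chosen for a subgroup of \<open>\<Delta>\<close> can serve as \<open>x1\<close>.\<close>

lemma reduction:
  assumes "\<not> coarsely_dense V G"
  shows "\<exists>\<Delta> V1. discrete_motion_group_on \<Delta> V1 \<and> \<Delta> \<subseteq> G \<and> V1 \<subset> V
    \<and> (\<forall>x1 R. \<exists>x. \<forall>f\<in>G. dist (f x) x \<le> R \<longrightarrow> f \<in> \<Delta> \<and> dist (f x1) x1 \<le> R)"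
proof -
  obtain L B where L: "subspace L" "L \<subseteq> V" "L \<noteq> {0}"
      "\<And>f v. f \<in> G \<Longrightarrow> v \<in> L \<Longrightarrow> linear_part f v \<in> L"
    and B: "0 \<le> B" "\<And>f v. f \<in> G \<Longrightarrow> v \<in> L \<Longrightarrow> \<bar>f 0 \<bullet> v\<bar> \<le> B * norm v"
    using bounded_subspace[OF assms] by blast
  define V1 where "V1 = V \<inter> L\<^sup>\<bottom>"
  define \<Delta> where "\<Delta> = {f \<in> G. \<forall>w\<in>V1\<^sup>\<bottom>. linear_part f w = w}"
  have V1: "subspace V1"
    unfolding V1_def by (intro subspace_inter subspace subspace_orthogonal_comp)
  have L_orth: "L \<subseteq> V1\<^sup>\<bottom>" by (auto simp: V1_def orthogonal_comp_def orthogonal_commute)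
  have "V1 \<noteq> V"
  proof
    assume "V1 = V"
    then have "l \<bullet> l = 0" if "l \<in> L" for l
      using L(2) that by (force simp: V1_def orthogonal_comp_def orthogonal_def)
    then have "l = 0" if "l \<in> L" for l using that by simp
    then show False using L(1,3) subspace_0 by blast
  qed
  then have V1_less: "V1 \<subset> V" by (auto simp: V1_def)
  have V1_linear_part: "linear_part f x \<in> V1" if "f \<in> G" "x \<in> V1" for f x
    using that linear_part_in linear_part_orthogonal_comp[OF L(4)] by (auto simp: V1_def)
  have V1_orth: "linear_part f w \<in> V1\<^sup>\<bottom>" if "f \<in> G" "w \<in> V1\<^sup>\<bottom>" for f w
    using linear_part_orthogonal_comp[OF V1_linear_part] that by blast

  interpret \<Delta>: discrete_motion_group \<Delta>
  proof (rule subgroup)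
    show "id \<in> \<Delta>" using id_in by (simp add: \<Delta>_def linear_part_def)
    show "f \<circ> h \<in> \<Delta>" if "f \<in> \<Delta>" "h \<in> \<Delta>" for f h
      using that by (auto simp: \<Delta>_def linear_part_comp comp_in)
    show "inv f \<in> \<Delta>" if "f \<in> \<Delta>" for f
    proof -
      have f: "f \<in> G" using that by (simp add: \<Delta>_def)
      have "inv (linear_part f) w = w" if "linear_part f w = w" for w
        using that orthogonal_transformation_bij[OF orthogonal_linear_part[OF f]]
        by (metis bij_inv_eq_iff)
      then show ?thesis using that by (auto simp: \<Delta>_def linear_part_inv inv_in)
    qed
  qed (auto simp: \<Delta>_def)
  have "discrete_motion_group_on \<Delta> V1"
  proof
    fix f assume f: "f \<in> \<Delta>"
    then have fG: "f \<in> G" by (simp add: \<Delta>_def)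
    \<comment> \<open>Linear parts of elements of \<open>\<Delta>\<close> fix \<open>L\<close>, so
      the bounded functionals from \<open>L\<close> vanish on their translations.\<close>
    have "f 0 \<bullet> l = 0" if l: "l \<in> L" for l
    proof (rule \<Delta>.translation_orthogonal_fixed[OF _ _ f])
      show "linear_part h l = l" if "h \<in> \<Delta>" for h using that l L_orth by (auto simp: \<Delta>_def)
      show "h 0 \<bullet> l \<le> B * norm l" if "h \<in> \<Delta>" for h
        using that B(2)[OF _ l, of h] by (auto simp: \<Delta>_def)
    qed
    then have "f 0 \<in> V1"
      using translation_in[OF fG] by (auto simp: V1_def orthogonal_comp_def orthogonal_def inner_commute)
    then show "motion_of V1 f"
      using f fG V1_linear_part orthogonal_linear_part by (auto simp: motion_of_iff \<Delta>_def)
  qed (rule V1)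

  have "\<exists>u\<in>V1\<^sup>\<bottom>. \<forall>f\<in>G - \<Delta>. linear_part f u \<noteq> u"
  proof -
    \<comment> \<open>\<open>N f\<close> consists of the points whose component orthogonal to
      \<open>V1\<close> is fixed by the linear part. Outside \<open>\<Delta>\<close> it is a proper
      subspace of the whole space, so countably many of them form a null set.\<close>
    define N where "N f = {z. linear_part f z - z \<in> V1}" for f
    have "negligible (N f)" if f: "f \<in> G - \<Delta>" for f
    proof (rule negligible_lowdim)
      have fG: "f \<in> G" using f by simp
      have "subspace (N f)"
      proof (rule subspaceI)
        show "0 \<in> N f" using subspace_0[OF V1] by (simp add: N_def linear_part_def)
        show "x + y \<in> N f" if "x \<in> N f" "y \<in> N f" for x y
          using subspace_add[OF V1, of "linear_part f x - x" "linear_part f y - y"] that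
          by (simp add: N_def linear_add[OF linear_linear_part[OF fG]] algebra_simps)
        show "c *\<^sub>R x \<in> N f" if "x \<in> N f" for c x
          using subspace_scale[OF V1, of "linear_part f x - x" c] that
          by (simp add: N_def linear_cmul[OF linear_linear_part[OF fG]] algebra_simps)
      qed
      moreover obtain w where w: "w \<in> V1\<^sup>\<bottom>" "linear_part f w \<noteq> w" using f by (auto simp: \<Delta>_def)
      have "w \<notin> N f"
      proof
        assume "w \<in> N f"
        moreover have "linear_part f w - w \<in> V1\<^sup>\<bottom>"
          using V1_orth[OF fG w(1)] w(1) by (simp add: subspace_diff subspace_orthogonal_comp)
        ultimately have "linear_part f w - w \<in> V1 \<inter> V1\<^sup>\<bottom>" by (simp add: N_def)
        then show False using w(2) by (auto simp: orthogonal_comp_def orthogonal_def)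
      qed
      ultimately show "dim (N f) < DIM('a)"
        by (metis UNIV_I dim_eq_full dim_subset_UNIV le_neq_implies_less span_eq_iff)
    qed
    then have "negligible (\<Union>(N ` (G - \<Delta>)))"
      using countable by (intro negligible_countable_Union) auto
    then obtain z where z: "\<And>f. f \<in> G - \<Delta> \<Longrightarrow> z \<notin> N f"
      by (metis UN_iff UNIV_eq_I non_negligible_UNIV)
    obtain y u where yu: "y \<in> V1" "u \<in> V1\<^sup>\<bottom>" "z = y + u" using orthogonal_decomp[OF V1] .
    have "linear_part f u \<noteq> u" if f: "f \<in> G - \<Delta>" for f
    proof
      assume "linear_part f u = u"
      then have "linear_part f z - z = linear_part f y - y"
        using linear_add[OF linear_linear_part, of f y u] f by (simp add: yu(3))
      then have "z \<in> N f" using subspace_diff[OF V1 V1_linear_part yu(1), of f] f yu(1) by (simp add: N_def)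
      then show False using z f by blast
    qed
    then show ?thesis using yu by blast
  qed
  then obtain u where u: "u \<in> V1\<^sup>\<bottom>" "\<And>f. f \<in> G \<Longrightarrow> f \<notin> \<Delta> \<Longrightarrow> linear_part f u \<noteq> u" by blast

  have "\<exists>x. \<forall>f\<in>G. dist (f x) x \<le> R \<longrightarrow> f \<in> \<Delta> \<and> dist (f x1) x1 \<le> R" for x1 R
  proof -
    \<comment> \<open>An element moving \<open>x\<close> by at most \<open>R\<close> will have its
      component \<open>w\<close> bounded by \<open>C\<close>, hence its translation bounded as in
      \<open>F\<close>. The factor \<open>t\<close> is so large that no element of the finite set
      \<open>F\<close> meets the bound on \<open>w\<close>.\<close>
    define C where "C = R + 2 * norm x1 + B"
    define F where "F = {f \<in> G. norm (f 0) \<le> R + 2 * norm x1 + C} - \<Delta>"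
    define t where "t = (\<Sum>f\<in>F. (\<bar>C\<bar> + 1) / norm (linear_part f u - u))"
    have "finite F" using finite_bounded by (simp add: F_def)
    have t: "0 \<le> t" unfolding t_def by (intro sum_nonneg) auto
    have far: "C < t * norm (linear_part f u - u)" if f: "f \<in> F" for f
    proof -
      have "(\<bar>C\<bar> + 1) / norm (linear_part f u - u) \<le> t"
        unfolding t_def by (rule member_le_sum) (use f \<open>finite F\<close> in auto)
      moreover have "0 < norm (linear_part f u - u)" using u(2) f by (auto simp: F_def)
      ultimately have "\<bar>C\<bar> + 1 \<le> t * norm (linear_part f u - u)" by (simp add: field_simps)
      then show ?thesis by linarith
    qed
    define x where "x = x1 + t *\<^sub>R u"
    have "f \<in> \<Delta> \<and> dist (f x1) x1 \<le> R" if f: "f \<in> G" and d: "dist (f x) x \<le> R" for f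
    proof -
      define w where "w = t *\<^sub>R (linear_part f u - u)"
      define r where "r = linear_part f x1 - x1"
      have sum: "f x - x = r + f 0 + w"
        using linear_add[OF linear_linear_part[OF f], of x1 "t *\<^sub>R u"] linear_cmul[OF linear_linear_part[OF f], of t u]
        by (simp add: x_def r_def w_def linear_part_def[of f "x1 + t *\<^sub>R u"] algebra_simps)
      have r: "norm r \<le> 2 * norm x1"
        using norm_triangle_ineq4[of "linear_part f x1" x1] norm_linear_part[OF f] by (simp add: r_def)
      have w_orth: "w \<in> V1\<^sup>\<bottom>"
        unfolding w_def using V1_orth[OF f u(1)] u(1)
        by (intro subspace_scale subspace_diff subspace_orthogonal_comp)
      \<comment> \<open>Only the component of \<open>f 0\<close> in \<open>L\<close> pairs with
        \<open>w\<close>, since the rest lies in \<open>V1\<close>. Testing the bound for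
        \<open>L\<close> on that component itself shows its norm is at most
        \<open>B\<close>.\<close>
      have wf: "\<bar>w \<bullet> f 0\<bar> \<le> norm w * B"
      proof -
        obtain \<beta> \<alpha> where ab: "\<beta> \<in> L" "\<alpha> \<in> L\<^sup>\<bottom>" "f 0 = \<beta> + \<alpha>" using orthogonal_decomp[OF L(1)] .
        then have "\<alpha> = f 0 - \<beta>" by simp
        moreover have "f 0 - \<beta> \<in> V" using subspace_diff[OF subspace translation_in[OF f]] ab(1) L(2) by blast
        ultimately have "\<alpha> \<in> V" by simp
        then have "w \<bullet> \<alpha> = 0" using w_orth ab
          by (auto simp: V1_def orthogonal_comp_def orthogonal_def inner_commute)
        moreover have "\<beta> \<bullet> \<alpha> = 0" using ab by (auto simp: orthogonal_comp_def orthogonal_def)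
        then have "f 0 \<bullet> \<beta> = norm \<beta> * norm \<beta>"
          by (simp add: ab(3) inner_add_left inner_commute[of \<alpha>] dot_square_norm power2_eq_square)
        then have "norm \<beta> * norm \<beta> \<le> B * norm \<beta>" using B(2)[OF f ab(1)] by simp
        then have "norm \<beta> \<le> B" using B(1) by (cases "norm \<beta> = 0") auto
        ultimately show ?thesis
          using Cauchy_Schwarz_ineq2[of w \<beta>] ab(3) mult_left_mono[of "norm \<beta>" B "norm w"]
          by (simp add: inner_add_right)
      qed
      \<comment> \<open>Pairing the displacement with \<open>w\<close> bounds \<open>w\<close>
        without any prior bound on the translation.\<close>
      have "norm w * norm w = w \<bullet> (f x - x) - w \<bullet> r - w \<bullet> f 0"
        by (simp add: sum inner_add_right dot_square_norm power2_eq_square)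
      also have "\<dots> \<le> norm w * R + norm w * (2 * norm x1) + norm w * B"
        using Cauchy_Schwarz_ineq2[of w "f x - x"] Cauchy_Schwarz_ineq2[of w r] wf
          mult_left_mono[OF d, of "norm w"] mult_left_mono[OF r, of "norm w"]
        by (simp add: dist_norm)
      finally have "norm w * norm w \<le> norm w * C" by (simp add: C_def algebra_simps)
      moreover have "0 \<le> R" using d zero_le_dist order_trans by blast
      ultimately have wC: "norm w \<le> C" using B(1) by (cases "norm w = 0") (auto simp: C_def)
      have "f 0 = (f x - x) - r - w" using sum by simp
      then have "norm (f 0) \<le> norm (f x - x) + norm r + norm w"
        by (metis add_right_mono norm_triangle_ineq4 order_trans)
      then have "norm (f 0) \<le> R + 2 * norm x1 + C" using d r wC by (simp add: dist_norm)
      then have "f \<in> \<Delta>" using far[of f] f wC t by (auto simp: F_def w_def)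
      then have "w = 0" using u(1) by (simp add: w_def \<Delta>_def)
      then have "f x - x = f x1 - x1" using sum by (simp add: r_def linear_part_def)
      then show ?thesis using \<open>f \<in> \<Delta>\<close> d by (simp add: dist_norm)
    qed
    then show ?thesis by blast
  qed
  moreover have "\<Delta> \<subseteq> G" by (auto simp: \<Delta>_def)
  ultimately show ?thesis using \<open>discrete_motion_group_on \<Delta> V1\<close> V1_less by blast
qed

end

section \<open>Induction on the dimension\<close>

text \<open>Each use of \<open>reduction\<close> strictly lowers the dimension of the subspace, and
  a coarsely dense group serves as its own \<open>\<Delta>\<close>.\<close>

lemma exists_coarsely_dense_subgroup:
  assumes "discrete_motion_group_on G V"
  shows "\<exists>\<Delta> V'. discrete_motion_group_on \<Delta> V' \<and> \<Delta> \<subseteq> G \<and> coarsely_dense V' \<Delta>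
      \<and> (\<forall>R. \<exists>x. \<forall>f\<in>G. dist (f x) x \<le> R \<longrightarrow> f \<in> \<Delta>)"
  using assms
proof (induction "dim V" arbitrary: G V rule: less_induct)
  case less
  interpret discrete_motion_group_on G V by (rule less.prems)
  show ?case
  proof (cases "coarsely_dense V G")
    case True
    then show ?thesis using less.prems by blast
  next
    case False
    obtain \<Delta> V1 where D: "discrete_motion_group_on \<Delta> V1" "\<Delta> \<subseteq> G" "V1 \<subset> V"
        "\<And>x1 R. \<exists>x. \<forall>f\<in>G. dist (f x) x \<le> R \<longrightarrow> f \<in> \<Delta> \<and> dist (f x1) x1 \<le> R"
      using reduction[OF False] by blast
    have "dim V1 < dim V"
      using D(3) subspace discrete_motion_group_on.subspace[OF D(1)]
      by (intro dim_psubset) (simp add: span_eq_iff[THEN iffD2])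
    then obtain \<Delta>' V' where D': "discrete_motion_group_on \<Delta>' V'" "\<Delta>' \<subseteq> \<Delta>" "coarsely_dense V' \<Delta>'"
        "\<And>R. \<exists>x. \<forall>f\<in>\<Delta>. dist (f x) x \<le> R \<longrightarrow> f \<in> \<Delta>'"
      using less.hyps[OF _ D(1)] by blast
    have "\<exists>x. \<forall>f\<in>G. dist (f x) x \<le> R \<longrightarrow> f \<in> \<Delta>'" for R
    proof -
      obtain x1 where x1: "\<forall>f\<in>\<Delta>. dist (f x1) x1 \<le> R \<longrightarrow> f \<in> \<Delta>'" using D'(4) by blast
      obtain x where "\<forall>f\<in>G. dist (f x) x \<le> R \<longrightarrow> f \<in> \<Delta> \<and> dist (f x1) x1 \<le> R" using D(4) by blast
      then show ?thesis using x1 by blast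
    qed
    then have "\<forall>R. \<exists>x. \<forall>f\<in>G. dist (f x) x \<le> R \<longrightarrow> f \<in> \<Delta>'" by blast
    moreover have "\<Delta>' \<subseteq> G" using D(2) D'(2) by blast
    ultimately show ?thesis using D'(1,3) by (intro exI[of _ \<Delta>'] exI[of _ V'] conjI)
  qed
qed

section \<open>Orbit distances and compactness of the quotient\<close>

context discrete_motion_group
begin

lemma orbit_apply:
  assumes "f \<in> G"
  shows "orbit G (f x) = orbit G x"
proof -
  have "orbit G (h y) \<subseteq> orbit G y" if "h \<in> G" for h y
    unfolding orbit_def by (auto intro: rev_image_eqI[OF comp_in[OF _ that]])
  from this[OF assms, of x] this[OF inv_in[OF assms], of "f x"] show ?thesis
    by (simp add: inv_apply[OF assms])
qed

lemma in_orbit: "x \<in> orbit G x"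
  unfolding orbit_def by (rule rev_image_eqI[OF id_in]) simp

text \<open>Applying the inverse of the element that moves \<open>y\<close> reduces the infimum over
  two orbits to one over the group.\<close>

lemma odist_orbit: "odist (orbit G x) (orbit G y) = (INF f\<in>G. dist (f x) y)"
proof -
  have "\<exists>k\<in>G. dist (f x) (h y) = dist (k x) y" if "f \<in> G" "h \<in> G" for f h
    using dist_apply[OF inv_in[OF that(2)], of "f x" "h y"] inv_apply(1)[OF that(2)]
      comp_in[OF inv_in[OF that(2)] that(1)] by (intro bexI[of _ "inv h \<circ> f"]) auto
  then have "{dist a b |a b. a \<in> orbit G x \<and> b \<in> orbit G y} = (\<lambda>f. dist (f x) y) ` G"
    using in_orbit[of y] by (auto simp: orbit_def)
  then show ?thesis by (simp add: odist_def)
qed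

end

context discrete_motion_group_on
begin

text \<open>A closed ball in \<open>V\<close> meets every orbit. It is compact, and a finite
  subcover of it already covers all orbits, because each open set involved is a union of
  orbits.\<close>

lemma quot_compact:
  assumes "coarsely_dense V G"
  shows "quot_compact V G"
  unfolding quot_compact_def
proof (intro allI impI, elim conjE)
  fix \<U>
  assume open_U: "\<forall>U\<in>\<U>. U \<subseteq> quot_points V G \<and> openin (top_of_set V) (\<Union>U)"
    and cover: "quot_points V G \<subseteq> \<Union>\<U>"
  obtain R where R: "\<And>x. x \<in> V \<Longrightarrow> \<exists>f\<in>G. dist x (f 0) \<le> R"
    using assms by (auto simp: coarsely_dense_def)
  define K where "K = V \<inter> cball 0 R"
  have "compact K" by (simp add: K_def closed_Int_compact closed_subspace subspace)
  obtain T where T: "\<And>U. U \<in> \<U> \<Longrightarrow> open (T U)" "\<And>U. U \<in> \<U> \<Longrightarrow> \<Union>U = V \<inter> T U"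
    using open_U unfolding openin_open by metis
  have "K \<subseteq> (\<Union>U\<in>\<U>. T U)"
  proof
    fix x assume x: "x \<in> K"
    then obtain U where "U \<in> \<U>" "orbit G x \<in> U" using cover by (auto simp: K_def quot_points_def)
    then show "x \<in> (\<Union>U\<in>\<U>. T U)" using T(2) in_orbit[of x] by blast
  qed
  then obtain \<V> where V: "\<V> \<subseteq> \<U>" "finite \<V>" "K \<subseteq> (\<Union>U\<in>\<V>. T U)"
    using \<open>compact K\<close> T(1) by (metis compactE_image)
  have "quot_points V G \<subseteq> \<Union>\<V>"
  proof
    fix z assume "z \<in> quot_points V G"
    then obtain x where x: "x \<in> V" "z = orbit G x" by (auto simp: quot_points_def)
    obtain f where f: "f \<in> G" "dist x (f 0) \<le> R" using R x by blast
    have "dist (inv f x) 0 \<le> R"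
      using f dist_apply[OF f(1), of "inv f x" 0] inv_apply[OF f(1)] by simp
    then have inV: "inv f x \<in> K" using apply_in[OF inv_in[OF f(1)] x(1)] by (simp add: K_def)
    then obtain U where U: "U \<in> \<V>" "inv f x \<in> T U" using V(3) by blast
    then have "U \<in> \<U>" using V(1) by blast
    then have "inv f x \<in> \<Union>U" "U \<subseteq> orbit G ` V"
      using T(2) U(2) inV open_U by (auto simp: K_def quot_points_def)
    then obtain y where y: "orbit G y \<in> U" "inv f x \<in> orbit G y" by blast
    then obtain k where "k \<in> G" "inv f x = k y" by (auto simp: orbit_def)
    then have "orbit G y = z" using orbit_apply[of k y] orbit_apply[OF inv_in[OF f(1)], of x] x(2) by simp
    then show "z \<in> \<Union>\<V>" using U y by blast
  qed
  then show "\<exists>\<V>\<subseteq>\<U>. finite \<V> \<and> quot_points V G \<subseteq> \<Union>\<V>" using V by blast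
qed

end

section \<open>The embedding of the product\<close>

text \<open>Near a point \<open>x\<close> moved little only by \<open>\<Delta>\<close>, distances
  between \<open>G\<close>-orbits are computed by elements of \<open>\<Delta>\<close> alone, and
  those distances split by Pythagoras. The map obtained preserves distances globally, not only
  locally.\<close>

lemma isometric_embedding_exists:
  fixes G \<Delta> :: "('a::euclidean_space \<Rightarrow> 'a) set"
  assumes "discrete_motion_group G" and "discrete_motion_group_on \<Delta> V" and sub: "\<Delta> \<subseteq> G"
    and dense: "coarsely_dense V \<Delta>"
    and far: "\<And>R. \<exists>x. \<forall>f\<in>G. dist (f x) x \<le> R \<longrightarrow> f \<in> \<Delta>"
  shows "\<exists>f. isometric_embedding (quot_points V \<Delta> \<times> {b \<in> V\<^sup>\<bottom>. norm b < R}) (quot_points UNIV G) f"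
proof -
  interpret G: discrete_motion_group G by fact
  interpret \<Delta>: discrete_motion_group_on \<Delta> V by fact
  obtain r where r: "\<And>x. x \<in> V \<Longrightarrow> \<exists>f\<in>\<Delta>. dist x (f 0) \<le> r"
    using dense by (auto simp: coarsely_dense_def)
  \<comment> \<open>\<open>\<rho>\<close> bounds the distance to \<open>x\<close> of all
    representatives used. An element bringing one of them within \<open>2 * \<rho>\<close> of
    another moves \<open>x\<close> by at most \<open>\<rho> + 2 * \<rho> + \<rho>\<close>.\<close>
  define \<rho> where "\<rho> = 2 * r + R"
  obtain x where x: "\<And>f. f \<in> G \<Longrightarrow> dist (f x) x \<le> 4 * \<rho> \<Longrightarrow> f \<in> \<Delta>" using far by blast
  obtain c a where ca: "c \<in> V" "a \<in> V\<^sup>\<bottom>" "x = c + a" using orthogonal_decomp[OF \<Delta>.subspace] .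
  \<comment> \<open>The chosen representative is immaterial, since elements of
    \<open>\<Delta>\<close> commute with adding vectors orthogonal to \<open>V\<close>. The shift by
    \<open>a\<close> centres the ball at the component of \<open>x\<close> orthogonal to
    \<open>V\<close>.\<close>
  define F where "F = (\<lambda>(z, w). orbit G ((SOME v. v \<in> z) + (w + a)))"
  define good where "good z v \<longleftrightarrow> v \<in> V \<and> z = orbit \<Delta> v \<and> dist v c \<le> 2 * r
      \<and> (\<forall>w\<in>V\<^sup>\<bottom>. F (z, w) = orbit G (v + (w + a)))" for z v
  have add_a: "w + a \<in> V\<^sup>\<bottom>" if "w \<in> V\<^sup>\<bottom>" for w
    using that ca(2) by (intro subspace_add subspace_orthogonal_comp)
  have ex_good: "\<exists>v. good z v" if z: "z \<in> quot_points V \<Delta>" for z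
  proof -
    obtain v0 where v0: "v0 \<in> V" "z = orbit \<Delta> v0" using z by (auto simp: quot_points_def)
    obtain f h where fh: "f \<in> \<Delta>" "dist v0 (f 0) \<le> r" "h \<in> \<Delta>" "dist c (h 0) \<le> r"
      using r[OF v0(1)] r[OF ca(1)] by blast
    \<comment> \<open>The orbit point \<open>f 0\<close> near \<open>v0\<close> is carried to the
      orbit point \<open>h 0\<close> near \<open>c\<close>, whence the bound
      \<open>2 * r\<close>.\<close>
    define v where "v = h (inv f v0)"
    have "dist v (h 0) = dist v0 (f 0)"
      using \<Delta>.dist_apply[OF fh(3), of "inv f v0" 0] \<Delta>.dist_apply[OF fh(1), of "inv f v0" 0]
        \<Delta>.inv_apply[OF fh(1)] by (simp add: v_def)
    then have vc: "dist v c \<le> 2 * r" using fh dist_triangle2[of v c "h 0"] by linarith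
    have zv: "z = orbit \<Delta> v"
      using v0 \<Delta>.orbit_apply[OF fh(3)] \<Delta>.orbit_apply[OF \<Delta>.inv_in[OF fh(1)]] by (simp add: v_def)
    have "(SOME v. v \<in> z) \<in> z" using \<Delta>.in_orbit[of v] zv by (metis someI)
    then obtain k where k: "k \<in> \<Delta>" "(SOME v. v \<in> z) = k v" by (auto simp: zv orbit_def)
    have "F (z, w) = orbit G (v + (w + a))" if "w \<in> V\<^sup>\<bottom>" for w
    proof -
      have "F (z, w) = orbit G (k v + (w + a))" by (simp only: F_def k(2) prod.case)
      also have "\<dots> = orbit G (k (v + (w + a)))"
        by (simp only: \<Delta>.apply_add_orthogonal[OF k(1) add_a[OF that]])
      also have "\<dots> = orbit G (v + (w + a))" using k(1) sub by (intro G.orbit_apply) blast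
      finally show ?thesis .
    qed
    moreover have "v \<in> V"
      unfolding v_def by (rule \<Delta>.apply_in[OF fh(3) \<Delta>.apply_in[OF \<Delta>.inv_in[OF fh(1)] v0(1)]])
    ultimately show ?thesis unfolding good_def using zv vc by blast
  qed
  have split: "(dist (f (v + (w + a))) (v' + (w' + a)))\<^sup>2 = (dist (f v) v')\<^sup>2 + (dist w w')\<^sup>2"
    if "f \<in> \<Delta>" "v \<in> V" "v' \<in> V" "w \<in> V\<^sup>\<bottom>" "w' \<in> V\<^sup>\<bottom>" for f v v' w w'
  proof -
    have "f (v + (w + a)) - (v' + (w' + a)) = (f v - v') + (w - w')"
      using \<Delta>.apply_add_orthogonal[OF that(1) add_a[OF that(4)], of v] by simp
    moreover have "f v - v' \<in> V" "w - w' \<in> V\<^sup>\<bottom>"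
      using that \<Delta>.apply_in \<Delta>.subspace by (auto simp: subspace_diff subspace_orthogonal_comp)
    then have "orthogonal (f v - v') (w - w')" by (simp add: orthogonal_comp_def)
    ultimately show ?thesis by (simp only: dist_norm norm_add_Pythagorean)
  qed
  have near: "dist (v + (w + a)) x \<le> \<rho>" if "dist v c \<le> 2 * r" "norm w < R" for v w
    using that norm_triangle_ineq[of "v - c" w] by (simp add: ca(3) \<rho>_def dist_norm algebra_simps)
  have in_\<Delta>: "f \<in> \<Delta>"
    if "f \<in> G" "dist v c \<le> 2 * r" "norm w < R" "dist v' c \<le> 2 * r" "norm w' < R"
      "dist (f (v + (w + a))) (v' + (w' + a)) \<le> 2 * \<rho>" for f v v' w w'
  proof -
    let ?y = "v + (w + a)" and ?y' = "v' + (w' + a)"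
    have "dist (f x) x \<le> dist (f x) (f ?y) + dist (f ?y) ?y' + dist ?y' x"
      using dist_triangle[of "f x" x "?y'"] dist_triangle[of "f x" "?y'" "f ?y"] by linarith
    also have "\<dots> \<le> 4 * \<rho>"
      using near[OF that(2,3)] near[OF that(4,5)] that(6) G.dist_apply[OF that(1), of x ?y]
      by (simp add: dist_commute)
    finally show ?thesis using x that(1) by blast
  qed
  define D where "D = quot_points V \<Delta> \<times> {b \<in> V\<^sup>\<bottom>. norm b < R}"
  have isometric: "odist (F p) (F q) = prod_dist p q" if pq: "p \<in> D" "q \<in> D" for p q
  proof -
    obtain z w z' w' where eq: "p = (z, w)" "q = (z', w')" by fastforce
    have w: "w \<in> V\<^sup>\<bottom>" "w' \<in> V\<^sup>\<bottom>" "norm w < R" "norm w' < R" using pq by (auto simp: D_def eq)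
    obtain v v' where v: "good z v" "good z' v'" using pq ex_good by (fastforce simp: D_def eq)
    have vV: "v \<in> V" "v' \<in> V" "dist v c \<le> 2 * r" "dist v' c \<le> 2 * r" using v by (auto simp: good_def)
    let ?y = "v + (w + a)" and ?y' = "v' + (w' + a)"
    define I where "I = (INF f\<in>G. dist (f ?y) ?y')"
    define J where "J = (INF f\<in>\<Delta>. dist (f v) v')"
    define d where "d = dist w w'"
    have bdd: "bdd_below ((\<lambda>f. dist (f p) q) ` H)" for p q :: 'a and H
      by (auto intro!: bdd_belowI[of _ 0])
    have J_le: "J \<le> dist (f v) v'" if "f \<in> \<Delta>" for f
      unfolding J_def by (rule cINF_lower[OF bdd that])
    have J0: "0 \<le> J" unfolding J_def using \<Delta>.id_in by (intro cINF_greatest) auto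
    have I0: "0 \<le> I" unfolding I_def using G.id_in by (intro cINF_greatest) auto
    have lower: "sqrt (J\<^sup>2 + d\<^sup>2) \<le> dist (f ?y) ?y'" if "f \<in> \<Delta>" for f
    proof -
      have "J\<^sup>2 \<le> (dist (f v) v')\<^sup>2" by (rule power_mono[OF J_le[OF that] J0])
      then show ?thesis
        using split[OF that vV(1,2) w(1,2)] by (intro real_le_lsqrt) (auto simp: d_def)
    qed
    have "sqrt (J\<^sup>2 + d\<^sup>2) \<le> dist (f ?y) ?y'" if f: "f \<in> G" for f
    proof (cases "dist (f ?y) ?y' \<le> 2 * \<rho>")
      case True
      then show ?thesis using in_\<Delta>[OF f vV(3) w(3) vV(4) w(4)] lower by blast
    next
      case False
      \<comment> \<open>The identity already achieves at most \<open>2 * \<rho>\<close>, so elements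
        giving larger distances cannot lower the infimum.\<close>
      have "sqrt (J\<^sup>2 + d\<^sup>2) \<le> dist ?y ?y'" using lower[OF \<Delta>.id_in] by simp
      also have "\<dots> \<le> 2 * \<rho>"
        using near[OF vV(3) w(3)] near[OF vV(4) w(4)] dist_triangle2[of ?y ?y' x] by linarith
      finally show ?thesis using False by linarith
    qed
    then have "sqrt (J\<^sup>2 + d\<^sup>2) \<le> I" unfolding I_def using G.id_in by (intro cINF_greatest) auto
    moreover have "I \<le> sqrt (J\<^sup>2 + d\<^sup>2)"
    proof -
      \<comment> \<open>The infimum \<open>J\<close> need not be attained, so the inequality is
        solved for \<open>dist (f v) v'\<close> before passing to it; \<open>max 0\<close> keeps the
        square root meaningful.\<close>
      have "sqrt (max 0 (I\<^sup>2 - d\<^sup>2)) \<le> dist (f v) v'" if f: "f \<in> \<Delta>" for f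
      proof -
        have "I \<le> dist (f ?y) ?y'" unfolding I_def by (rule cINF_lower[OF bdd]) (use f sub in auto)
        then have "I\<^sup>2 \<le> (dist (f ?y) ?y')\<^sup>2" using I0 by (rule power_mono)
        then have "I\<^sup>2 \<le> (dist (f v) v')\<^sup>2 + d\<^sup>2" using split[OF f vV(1,2) w(1,2)] by (simp add: d_def)
        then show ?thesis by (intro real_le_lsqrt) auto
      qed
      then have "sqrt (max 0 (I\<^sup>2 - d\<^sup>2)) \<le> J"
        unfolding J_def using \<Delta>.id_in by (intro cINF_greatest) auto
      then have "I\<^sup>2 - d\<^sup>2 \<le> J\<^sup>2" using sqrt_le_D by fastforce
      then show ?thesis by (intro real_le_rsqrt) simp
    qed
    ultimately have "I = sqrt (J\<^sup>2 + d\<^sup>2)" by simp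
    moreover have "F p = orbit G ?y" "F q = orbit G ?y'"
      using v w unfolding eq good_def by blast+
    then have "odist (F p) (F q) = I" by (simp only: I_def G.odist_orbit)
    moreover have "z = orbit \<Delta> v" "z' = orbit \<Delta> v'" using v unfolding good_def by blast+
    then have "odist z z' = J" by (simp only: J_def \<Delta>.odist_orbit)
    ultimately show ?thesis by (simp add: prod_dist_def eq d_def)
  qed
  have inj: "inj_on F D"
  proof (rule inj_onI)
    fix p q assume pq: "p \<in> D" "q \<in> D" "F p = F q"
    obtain z w z' w' where eq: "p = (z, w)" "q = (z', w')" by fastforce
    have w: "w \<in> V\<^sup>\<bottom>" "w' \<in> V\<^sup>\<bottom>" "norm w < R" "norm w' < R" using pq by (auto simp: D_def eq)
    obtain v v' where v: "good z v" "good z' v'" using pq ex_good by (fastforce simp: D_def eq)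
    have vV: "v \<in> V" "v' \<in> V" "dist v c \<le> 2 * r" "dist v' c \<le> 2 * r" using v by (auto simp: good_def)
    have "F p = orbit G (v + (w + a))" "F q = orbit G (v' + (w' + a))"
      using v w unfolding eq good_def by blast+
    then have "v' + (w' + a) \<in> orbit G (v + (w + a))"
      using G.in_orbit[of "v' + (w' + a)"] pq(3) by simp
    then obtain f where f: "f \<in> G" "f (v + (w + a)) = v' + (w' + a)" by (auto simp: orbit_def)
    have "0 \<le> \<rho>" using near[OF vV(3) w(3)] zero_le_dist order_trans by blast
    then have "f \<in> \<Delta>" using in_\<Delta>[OF f(1) vV(3) w(3) vV(4) w(4)] f(2) by simp
    moreover from this have "f v = v'" "w = w'"
      using split[OF _ vV(1,2) w(1,2), of f] f(2) by (auto simp: sum_power2_eq_zero_iff)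
    ultimately show "p = q" using v \<Delta>.orbit_apply[of f v] by (auto simp: eq good_def)
  qed
  have "isometric_embedding D (quot_points UNIV G) F"
    unfolding isometric_embedding_def
  proof (intro conjI inj ballI)
    show "F ` D \<subseteq> quot_points UNIV G" by (auto simp: F_def quot_points_def)
    show "\<exists>e>0. \<forall>q\<in>D. \<forall>q'\<in>D. prod_dist p q < e \<and> prod_dist p q' < e
        \<longrightarrow> odist (F q) (F q') = prod_dist q q'" for p
      using isometric by (intro exI[of _ 1]) auto
  qed
  then show ?thesis unfolding D_def by blast
qed

theorem theorem3p6:
  fixes \<Gamma> :: "('a::euclidean_space \<Rightarrow> 'a) set"
  assumes "discrete_free_group UNIV \<Gamma>"
    and "\<not> quot_compact UNIV \<Gamma>"
  shows "\<exists>s::nat. 1 \<le> s \<and> s \<le> DIM('a) \<and>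
           (\<exists>V W (\<Gamma>'::('a \<Rightarrow> 'a) set).
              subspace V \<and> dim V = DIM('a) - s \<and> discrete_free_group V \<Gamma>' \<and> quot_compact V \<Gamma>' \<and>
              subspace W \<and> dim W = s \<and>
              (\<exists>R0. \<forall>R>R0. \<exists>f. isometric_embedding
                   (quot_points V \<Gamma>' \<times> {b\<in>W. norm b < R}) (quot_points UNIV \<Gamma>) f))"
proof -
  interpret \<Gamma>: discrete_motion_group \<Gamma> by unfold_locales fact
  interpret \<Gamma>: discrete_motion_group_on \<Gamma> UNIV
    by unfold_locales (use assms(1) in \<open>auto simp: discrete_free_group_def\<close>)
  obtain \<Delta> V where \<Delta>: "discrete_motion_group_on \<Delta> V" "\<Delta> \<subseteq> \<Gamma>" "coarsely_dense V \<Delta>"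
      "\<And>R. \<exists>x. \<forall>f\<in>\<Gamma>. dist (f x) x \<le> R \<longrightarrow> f \<in> \<Delta>"
    using exists_coarsely_dense_subgroup[OF \<Gamma>.discrete_motion_group_on_axioms] by blast
  interpret \<Delta>: discrete_motion_group_on \<Delta> V by (rule \<Delta>(1))
  \<comment> \<open>Noncompactness enters only here, and it yields \<open>s\<close> at least
    1.\<close>
  have "V \<noteq> UNIV"
  proof
    assume "V = UNIV"
    then have "coarsely_dense UNIV \<Gamma>" using \<Delta>(2,3) by (fastforce simp: coarsely_dense_def)
    then show False using \<Gamma>.quot_compact assms(2) by blast
  qed
  then have "dim V < DIM('a)"
    by (metis \<Delta>.subspace dim_eq_full dim_subset_UNIV le_neq_implies_less span_eq_iff)
  moreover have "dim (V\<^sup>\<bottom>) + dim V = DIM('a)"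
    using dim_subspace_orthogonal_to_vectors[OF \<Delta>.subspace subspace_UNIV] by (simp add: orthogonal_comp_def)
  \<comment> \<open>This holds for every \<open>R\<close>, so any threshold \<open>R0\<close> will
    do.\<close>
  moreover have "\<exists>f. isometric_embedding (quot_points V \<Delta> \<times> {b \<in> V\<^sup>\<bottom>. norm b < R}) (quot_points UNIV \<Gamma>) f" for R
    by (rule isometric_embedding_exists[OF \<Gamma>.discrete_motion_group_axioms \<Delta>])
  ultimately show ?thesis
    using \<Delta>.subspace \<Delta>.discrete_free_group \<Delta>.quot_compact[OF \<Delta>(3)] subspace_orthogonal_comp
    by (intro exI[of _ "dim (V\<^sup>\<bottom>)"] exI[of _ V] exI[of _ "V\<^sup>\<bottom>"] exI[of _ \<Delta>] conjI) auto
qed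

end
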